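(* Let $n, r, k$ be positive integers with $r \le n/2+1$, and let $\epsilon<1$. Any streaming algorithm which, for every hypergraph on $n$ vertices with hyperedges of arity at most $r$ given by a $k$-bounded deletion stream, produces a $(1\pm\epsilon)$ cut-sparsifier of the resulting hypergraph, must use $\Omega(nr\log(k/n))$ bits of space.
   Context: A hypergraph $H=(V,E)$ on vertex set $V$ with $|V|=n$ has hyperedges $e \subseteq V$; the arity of $e$ is $|e|$. Hypergraphs may carry nonnegative weights $w_e$. For $S \subseteq V$, $\mathrm{cut}_H(S)=\{e\in E: e\cap S\neq\emptyset,\ e\cap \bar S\neq\emptyset\}$ and $|\mathrm{cut}_H(S)|=\sum_{e\in \mathrm{cut}_H(S)} w_e$. A $(1\pm\epsilon)$ cut-sparsifier of $H$ is a reweighted sub-hypergraph $\widetilde H$ of $H$ (every hyperedge of $\widetilde H$ is a hyperedge of $H$) such that for every $S\subseteq V$, $|\mathrm{cut}_{\widetilde H}(S)| \in (1\pm\epsilon)|\mathrm{cut}_H(S)|$. A stream of hyperedges is a sequence of pairs $(e_i,\delta_i)$ with $e_i\subseteq V$, $\delta_i\in\{+1,-1\}$ ($+1$ insertion, $-1$ deletion); it is a $k$-bounded deletion stream if it has at most $k$ deletions. Streaming algorithms may be randomized and are required to succeed with probability at least $2/3$; space is the maximum number of bits of memory used while processing the stream.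
   Formalization: Two conditions are added, without which the claim fails: r ≥ 2 (for r = 1 nothing is ever cut, so no memory is needed) and k at most the number of possible hyperedges of arity at most r (the hypergraph can be stored exactly in that many bits, however large k is). *)

theory Defs
  imports "HOL-Probability.Probability"
begin

text \<open>The vertex set of an \<open>n\<close>-vertex hypergraph is \<open>{..<n}\<close>.  A weighted hypergraph is a pair of
  its hyperedge set and a weight function, of which only the values on the hyperedge set matter.\<close>

type_synonym whypergraph = "nat set set \<times> (nat set \<Rightarrow> real)"

definition hyperedges :: "nat \<Rightarrow> nat \<Rightarrow> nat set set" where
  "hyperedges n r = {e. e \<subseteq> {..<n} \<and> card e \<le> r}"

text \<open>The lower bound \<open>\<Omega>(n r log (k / n))\<close> needs \<open>r \<ge> 2\<close>, since hyperedges of arity at most 1 are never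
  cut, and \<open>k \<le> card (hyperedges n r)\<close>, since the current hypergraph can always be stored exactly in
  \<open>card (hyperedges n r)\<close> bits, however large \<open>k\<close> is.\<close>

definition cut :: "nat \<Rightarrow> nat set set \<Rightarrow> nat set \<Rightarrow> nat set set" where
  "cut n E S = {e \<in> E. e \<inter> S \<noteq> {} \<and> e \<inter> ({..<n} - S) \<noteq> {}}"

definition cut_weight :: "nat \<Rightarrow> whypergraph \<Rightarrow> nat set \<Rightarrow> real" where
  "cut_weight n H S = (\<Sum>e \<in> cut n (fst H) S. snd H e)"

definition cut_sparsifier :: "nat \<Rightarrow> real \<Rightarrow> whypergraph \<Rightarrow> whypergraph \<Rightarrow> bool" where
  "cut_sparsifier n \<epsilon> H H' \<longleftrightarrow>
     fst H' \<subseteq> fst H \<and> (\<forall>e \<in> fst H'. 0 \<le> snd H' e) \<and>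
     (\<forall>S. S \<subseteq> {..<n} \<longrightarrow>
        (1 - \<epsilon>) * cut_weight n H S \<le> cut_weight n H' S \<and>
        cut_weight n H' S \<le> (1 + \<epsilon>) * cut_weight n H S)"

type_synonym update = "nat set \<times> int"

definition multiplicity_in :: "update list \<Rightarrow> nat set \<Rightarrow> int" where
  "multiplicity_in \<sigma> e = (\<Sum>u \<leftarrow> filter (\<lambda>u. fst u = e) \<sigma>. snd u)"

text \<open>Hypergraphs are simple (\<open>E\<close> is a set of hyperedges), so in a stream only absent hyperedges
  are inserted and only present ones are deleted.\<close>

definition hyperedge_stream :: "nat \<Rightarrow> nat \<Rightarrow> update list \<Rightarrow> bool" where
  "hyperedge_stream n r \<sigma> \<longleftrightarrow>
     (\<forall>(e, \<delta>) \<in> set \<sigma>. e \<in> hyperedges n r \<and> \<delta> \<in> {1, -1}) \<and>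
     (\<forall>t \<le> length \<sigma>. \<forall>e. multiplicity_in (take t \<sigma>) e \<in> {0, 1})"

definition num_deletions :: "update list \<Rightarrow> nat" where
  "num_deletions \<sigma> = length (filter (\<lambda>u. snd u = -1) \<sigma>)"

definition bounded_deletion_stream :: "nat \<Rightarrow> nat \<Rightarrow> nat \<Rightarrow> update list \<Rightarrow> bool" where
  "bounded_deletion_stream n r k \<sigma> \<longleftrightarrow> hyperedge_stream n r \<sigma> \<and> num_deletions \<sigma> \<le> k"

definition resulting_hypergraph :: "update list \<Rightarrow> whypergraph" where
  "resulting_hypergraph \<sigma> = ({e. multiplicity_in \<sigma> e = 1}, \<lambda>_. 1)"

text \<open>A memory state is a bit string.  A machine may toss fresh coins when it initialises its
  memory, at every update, and when it produces its output; whatever it wants to remember has to be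
  kept in memory.  A streaming algorithm is a random machine: the choice of the machine models
  a read-only random seed that is not charged to the space.\<close>

record machine =
  initial :: "bool list pmf"
  update_step :: "bool list \<Rightarrow> update \<Rightarrow> bool list pmf"
  answer :: "bool list \<Rightarrow> whypergraph pmf"

type_synonym streaming_algorithm = "machine pmf"

definition memory_after :: "machine \<Rightarrow> update list \<Rightarrow> bool list pmf" where
  "memory_after M \<sigma> = foldl (\<lambda>p u. bind_pmf p (\<lambda>m. update_step M m u)) (initial M) \<sigma>"

definition output_of :: "streaming_algorithm \<Rightarrow> update list \<Rightarrow> whypergraph pmf" where
  "output_of A \<sigma> = bind_pmf A (\<lambda>M. bind_pmf (memory_after M \<sigma>) (answer M))"

definition produces_cut_sparsifiers ::
    "streaming_algorithm \<Rightarrow> nat \<Rightarrow> nat \<Rightarrow> nat \<Rightarrow> real \<Rightarrow> bool" where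
  "produces_cut_sparsifiers A n r k \<epsilon> \<longleftrightarrow>
     (\<forall>\<sigma>. bounded_deletion_stream n r k \<sigma> \<longrightarrow>
        2 / 3 \<le> measure_pmf.prob (output_of A \<sigma>)
                  {H'. cut_sparsifier n \<epsilon> (resulting_hypergraph \<sigma>) H'})"

text \<open>Prefixes of bounded deletion streams are again bounded deletion streams, so it suffices to
  look at the memory at the end of each stream.\<close>

definition space_usage :: "streaming_algorithm \<Rightarrow> nat \<Rightarrow> nat \<Rightarrow> nat \<Rightarrow> enat" where
  "space_usage A n r k =
     Sup {enat (length m) | m M \<sigma>. bounded_deletion_stream n r k \<sigma> \<and> M \<in> set_pmf A \<and>
            m \<in> set_pmf (memory_after M \<sigma>)}"

end

theory Submission
  imports Defs "HOL-Combinatorics.Permutations"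
begin

text \<open>Split the vertices into two halves.  Every vertex of the upper half carries about \<open>log k\<close> levels
  of hyperedges into the lower half; a level encodes a secret symbol of \<open>\<Theta>(r)\<close> bits by \<open>4 ^ j\<close> hyperedges,
  where \<open>j\<close> is the height of the level, and the names of the hyperedges at a vertex are scrambled by
  a random permutation.  Someone who knows the symbols of the higher levels of a vertex \<open>v\<close> can delete
  their hyperedges, at most \<open>k\<close> many.  Since \<open>\<epsilon> < 1\<close>, a cut sparsifier contains one of the surviving
  hyperedges at \<open>v\<close>; the permutation makes it uniformly distributed among them, so with probability
  at least \<open>2 / 3 * 3 / 4 = 1 / 2\<close> it lies in the highest surviving level and reveals its symbol.  Hence
  the memory after the insertions solves augmented indexing for \<open>\<Theta>(n log k)\<close> symbols of \<open>\<Theta>(r)\<close> bits.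
  Small \<open>n\<close> are absorbed by the constant, because at least one bit is always needed.\<close>

section \<open>Expectations over discrete distributions\<close>

lemma measure_bind_pmf:
  "measure_pmf.prob (bind_pmf p f) X = measure_pmf.expectation p (\<lambda>x. measure_pmf.prob (f x) X)"
proof -
  have "ennreal (measure_pmf.prob (bind_pmf p f) X) = (\<integral>\<^sup>+ x. ennreal (measure_pmf.prob (f x) X) \<partial>p)"
    by (simp flip: measure_pmf.emeasure_eq_measure)
  also have "\<dots> = ennreal (measure_pmf.expectation p (\<lambda>x. measure_pmf.prob (f x) X))"
    by (intro nn_integral_eq_integral measure_pmf.integrable_const_bound[where B = 1]) auto
  finally show ?thesis
    by (simp add: integral_nonneg)
qed

text \<open>For fixing the random seed: some machine in the support performs at least as well as the
  average.\<close>

lemma expectation_ge_imp_ex_set_pmf_ge: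
  fixes F :: "'a \<Rightarrow> real"
  assumes int: "integrable (measure_pmf p) F" and ge: "b \<le> measure_pmf.expectation p F"
  shows "\<exists>x \<in> set_pmf p. b \<le> F x"
proof (rule ccontr)
  assume "\<not> ?thesis"
  then have lt: "AE x in p. F x < b" by (auto simp: AE_measure_pmf_iff)
  have "measure_pmf.expectation p F < measure_pmf.expectation p (\<lambda>_. b)"
    using lt int by (intro measure_pmf.integral_less_AE_space) (auto simp: measure_pmf.emeasure_space_1)
  with ge show False by simp
qed

section \<open>Predicting a random word from a short memory\<close>

abbreviation words :: "nat \<Rightarrow> nat \<Rightarrow> nat list set" where
  "words q N \<equiv> {z. set z \<subseteq> {..<q} \<and> length z = N}"

lemma sum_words_Suc:
  "(\<Sum>z \<in> words q (Suc N). f z) = (\<Sum>a<q. \<Sum>z \<in> words q N. f (a # z))"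
proof -
  have "(\<Sum>z \<in> words q (Suc N). f z) = (\<Sum>(z, a) \<in> words q N \<times> {..<q}. f (a # z))"
    unfolding lists_length_Suc_eq by (subst sum.reindex) (auto simp: inj_on_def intro!: sum.cong)
  also have "\<dots> = (\<Sum>z \<in> words q N. \<Sum>a<q. f (a # z))"
    by (simp add: sum.cartesian_product)
  finally show ?thesis by (simp add: sum.swap[of _ "{..<q}"])
qed

text \<open>The first symbol \<open>a\<close> is peeled off, and the predictor for the remaining
  word is \<open>g\<close> with \<open>a\<close> prepended to the prefix. Summing the first factor
  over \<open>a\<close> gives \<open>q + (q - 1) * (\<Sum>a<q. g [] a)\<close>, at most
  \<open>2 * q\<close>, so each position costs a factor \<open>2 * q\<close>.\<close>

lemma sum_words_prod_predictor_le:
  fixes g :: "nat list \<Rightarrow> nat \<Rightarrow> real"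
  assumes q: "q \<ge> 1"
    and nonneg: "\<And>ys a. g ys a \<ge> 0"
    and sub: "\<And>ys. (\<Sum>a<q. g ys a) \<le> 1"
  shows "(\<Sum>z \<in> words q N. \<Prod>i<N. 1 + (real q - 1) * g (take i z) (z ! i)) \<le> (2 * real q) ^ N"
  using nonneg sub
proof (induction N arbitrary: g)
  case 0
  have "words q 0 = {[]}" by auto
  then show ?case by simp
next
  case (Suc N)
  have IH: "(\<Sum>z \<in> words q N. \<Prod>i<N. 1 + (real q - 1) * g (a # take i z) (z ! i)) \<le> (2 * real q) ^ N"
    for a using Suc.IH[of "\<lambda>ys. g (a # ys)"] Suc.prems by simp
  have "(\<Sum>z \<in> words q (Suc N). \<Prod>i<Suc N. 1 + (real q - 1) * g (take i z) (z ! i))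
      = (\<Sum>a<q. (1 + (real q - 1) * g [] a) *
          (\<Sum>z \<in> words q N. \<Prod>i<N. 1 + (real q - 1) * g (a # take i z) (z ! i)))"
    unfolding sum_words_Suc sum_distrib_left by (simp add: prod.lessThan_Suc_shift del: prod.lessThan_Suc)
  also have "\<dots> \<le> (\<Sum>a<q. (1 + (real q - 1) * g [] a) * (2 * real q) ^ N)"
    using q Suc.prems by (intro sum_mono mult_left_mono IH) auto
  also have "\<dots> = (real q + (real q - 1) * (\<Sum>a<q. g [] a)) * (2 * real q) ^ N"
    by (simp add: sum_distrib_left sum.distrib flip: sum_distrib_right)
  also have "\<dots> \<le> (2 * real q) * (2 * real q) ^ N"
  proof (rule mult_right_mono)
    have "(real q - 1) * (\<Sum>a<q. g [] a) \<le> (real q - 1) * 1"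
      using q Suc.prems by (intro mult_left_mono) auto
    then show "real q + (real q - 1) * (\<Sum>a<q. g [] a) \<le> 2 * real q" by simp
  qed simp
  finally show ?case by simp
qed

text \<open>By convexity, the graph of \<open>b powr p\<close> on the unit interval lies below its
  chord. This makes the weight of a position linear in the probability of a correct
  prediction.\<close>

lemma powr_le_chord:
  fixes b p :: real
  assumes "b > 0" "0 \<le> p" "p \<le> 1"
  shows "b powr p \<le> 1 + (b - 1) * p"
proof -
  have "exp ((1 - p) *\<^sub>R 0 + p *\<^sub>R ln b) \<le> (1 - p) * exp 0 + p * exp (ln b)"
    using assms by (intro convex_onD[OF exp_convex]) auto
  then show ?thesis using assms by (simp add: powr_def algebra_simps)
qed

text \<open>A lower bound for augmented indexing: the predictor for the symbol at position \<open>i\<close> may use the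
  memory and all earlier symbols.  Weighting words by \<open>q\<close> to the power of the expected number of
  correct predictions, each memory content contributes at most \<open>(2 * q) ^ N\<close>.\<close>

lemma augmented_index_memory_bound:
  fixes \<mu> :: "nat list \<Rightarrow> 'm pmf" and g :: "'m \<Rightarrow> nat list \<Rightarrow> nat \<Rightarrow> real"
  assumes q: "q \<ge> 1" and fin: "finite Mem"
    and mem: "\<And>z. z \<in> words q N \<Longrightarrow> set_pmf (\<mu> z) \<subseteq> Mem"
    and nonneg: "\<And>m ys a. g m ys a \<ge> 0"
    and sub: "\<And>m ys. (\<Sum>a<q. g m ys a) \<le> 1"
    and avg: "p * real N * real q ^ N \<le>
      (\<Sum>z \<in> words q N. \<Sum>i<N. measure_pmf.expectation (\<mu> z) (\<lambda>m. g m (take i z) (z ! i)))"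
  shows "real q powr (p * real N) \<le> real (card Mem) * 2 ^ N"
proof (cases "q = 1")
  case True
  have "words q N \<noteq> {}" using q by (auto intro!: exI[of _ "replicate N 0"] simp: set_replicate_conv_if split: if_splits)
  then obtain z where "z \<in> words q N" by blast
  with mem have "Mem \<noteq> {}" using set_pmf_not_empty by fastforce
  then have "card Mem \<ge> 1" using fin by (simp add: card_gt_0_iff Suc_le_eq)
  then have "1 * 1 \<le> real (card Mem) * 2 ^ N" by (intro mult_mono) auto
  then show ?thesis using True by simp
next
  case False
  with q have q1: "real q > 1" by simp
  let ?Z = "words q N"
  \<comment> \<open>For a fixed memory content \<open>m\<close>, this is the expected number of
    correctly predicted symbols of \<open>z\<close>.\<close>
  define h where "h z m = (\<Sum>i<N. g m (take i z) (z ! i))" for z m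
  have finZ: "finite ?Z" by (simp add: finite_lists_length_eq)
  have cardZ: "real (card ?Z) = real q ^ N" by (simp add: card_lists_length_eq)
  have pmf_sum: "(\<Sum>m\<in>Mem. pmf (\<mu> z) m) = 1" if "z \<in> ?Z" for z
    using mem[OF that] fin by (rule sum_pmf_eq_1[rotated])
  have avg': "p * real N * real q ^ N \<le> (\<Sum>z \<in> ?Z. \<Sum>m \<in> Mem. pmf (\<mu> z) m * h z m)"
  proof (rule order_trans[OF avg], rule sum_mono)
    fix z assume z: "z \<in> ?Z"
    have "(\<Sum>i<N. measure_pmf.expectation (\<mu> z) (\<lambda>m. g m (take i z) (z ! i)))
        = (\<Sum>i<N. \<Sum>m \<in> Mem. pmf (\<mu> z) m * g m (take i z) (z ! i))"
      using mem[OF z] by (intro sum.cong refl, subst integral_measure_pmf[OF fin]) auto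
    also have "\<dots> = (\<Sum>m \<in> Mem. pmf (\<mu> z) m * h z m)"
      by (simp add: sum.swap[of _ Mem] h_def sum_distrib_left)
    finally show "(\<Sum>i<N. measure_pmf.expectation (\<mu> z) (\<lambda>m. g m (take i z) (z ! i)))
        \<le> (\<Sum>m \<in> Mem. pmf (\<mu> z) m * h z m)" by simp
  qed
  define x0 where "x0 = p * real N"
  \<comment> \<open>The tangent to \<open>q powr x\<close> at \<open>x0\<close> takes the role of
    Jensen's inequality: the average of \<open>h\<close> is at least \<open>x0\<close>, so the
    linear term adds a nonnegative amount.\<close>
  have tangent: "real q powr x0 * (1 + (x - x0) * ln (real q)) \<le> real q powr x" for x
  proof -
    have "1 + (x - x0) * ln (real q) \<le> exp ((x - x0) * ln (real q))" by (rule exp_ge_add_one_self)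
    also have "\<dots> = real q powr (x - x0)" using q1 by (simp add: powr_def)
    finally have "real q powr x0 * (1 + (x - x0) * ln (real q)) \<le> real q powr x0 * real q powr (x - x0)"
      by (rule mult_left_mono) simp
    then show ?thesis by (simp flip: powr_add)
  qed
  have g_le1: "g m ys a \<le> 1" if "a < q" for m ys a
  proof -
    have "g m ys a \<le> (\<Sum>a<q. g m ys a)" using that nonneg by (intro member_le_sum) auto
    with sub show ?thesis by (meson order_trans)
  qed
  have chord: "real q powr h z m \<le> (\<Prod>i<N. 1 + (real q - 1) * g m (take i z) (z ! i))"
    if z: "z \<in> ?Z" for z m
  proof -
    have "real q powr h z m = (\<Prod>i<N. real q powr g m (take i z) (z ! i))"
      unfolding h_def using q1 by (subst powr_sum) auto
    also have "\<dots> \<le> (\<Prod>i<N. 1 + (real q - 1) * g m (take i z) (z ! i))"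
    proof (intro prod_mono conjI powr_le_chord)
      fix i assume "i \<in> {..<N}"
      with z have "z ! i < q" by (auto dest: nth_mem)
      then show "g m (take i z) (z ! i) \<le> 1" by (rule g_le1)
    qed (use q1 nonneg in auto)
    finally show ?thesis .
  qed
  have "real q ^ N * real q powr x0 =
      (\<Sum>z \<in> ?Z. \<Sum>m \<in> Mem. pmf (\<mu> z) m * real q powr x0)"
    by (simp add: pmf_sum cardZ flip: sum_distrib_right)
  also have "\<dots> \<le> (\<Sum>z \<in> ?Z. \<Sum>m \<in> Mem. pmf (\<mu> z) m * (real q powr x0 * (1 + (h z m - x0) * ln (real q))))"
  proof -
    have "(\<Sum>z \<in> ?Z. \<Sum>m \<in> Mem. pmf (\<mu> z) m * (real q powr x0 * (1 + (h z m - x0) * ln (real q))))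
       = (\<Sum>z \<in> ?Z. \<Sum>m \<in> Mem. pmf (\<mu> z) m * real q powr x0) + real q powr x0 * ln (real q) *
         ((\<Sum>z \<in> ?Z. \<Sum>m \<in> Mem. pmf (\<mu> z) m * h z m) - x0 * (\<Sum>z \<in> ?Z. \<Sum>m \<in> Mem. pmf (\<mu> z) m))"
      by (simp add: sum_distrib_left sum.distrib sum_subtractf algebra_simps)
    moreover have "(\<Sum>z \<in> ?Z. \<Sum>m \<in> Mem. pmf (\<mu> z) m) = real q ^ N"
      by (simp add: pmf_sum cardZ)
    moreover have "0 \<le> real q powr x0 * ln (real q) *
         ((\<Sum>z \<in> ?Z. \<Sum>m \<in> Mem. pmf (\<mu> z) m * h z m) - x0 * real q ^ N)"
      using avg' q1 by (intro mult_nonneg_nonneg) (auto simp: x0_def)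
    ultimately show ?thesis by simp
  qed
  \<comment> \<open>Bounding the probability of \<open>m\<close> by 1 removes the dependence of the
    memory on the word. Each \<open>m\<close> is then one fixed predictor, to which the product
    bound applies.\<close>
  also have "\<dots> \<le> (\<Sum>z \<in> ?Z. \<Sum>m \<in> Mem. 1 * (\<Prod>i<N. 1 + (real q - 1) * g m (take i z) (z ! i)))"
  proof (intro sum_mono)
    fix z m assume z: "z \<in> ?Z"
    have "pmf (\<mu> z) m * (real q powr x0 * (1 + (h z m - x0) * ln (real q)))
        \<le> pmf (\<mu> z) m * (\<Prod>i<N. 1 + (real q - 1) * g m (take i z) (z ! i))"
      by (intro mult_left_mono order_trans[OF tangent chord[OF z]]) simp
    also have "\<dots> \<le> 1 * (\<Prod>i<N. 1 + (real q - 1) * g m (take i z) (z ! i))"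
      using q1 nonneg by (intro mult_right_mono pmf_le_1 prod_nonneg) auto
    finally show "pmf (\<mu> z) m * (real q powr x0 * (1 + (h z m - x0) * ln (real q)))
        \<le> 1 * (\<Prod>i<N. 1 + (real q - 1) * g m (take i z) (z ! i))" .
  qed
  also have "\<dots> = (\<Sum>m \<in> Mem. \<Sum>z \<in> ?Z. \<Prod>i<N. 1 + (real q - 1) * g m (take i z) (z ! i))"
    by (subst sum.swap) simp
  also have "\<dots> \<le> (\<Sum>m \<in> Mem. (2 * real q) ^ N)"
    by (intro sum_mono sum_words_prod_predictor_le q nonneg sub)
  also have "\<dots> = real q ^ N * (real (card Mem) * 2 ^ N)" by (simp add: power_mult_distrib)
  finally show ?thesis using q1 by (simp add: x0_def)
qed

section \<open>Streams and machines\<close>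

definition continue :: "machine \<Rightarrow> update list \<Rightarrow> bool list \<Rightarrow> whypergraph pmf" where
  "continue M \<tau> m = bind_pmf (foldl (\<lambda>p u. bind_pmf p (\<lambda>m. update_step M m u)) (return_pmf m) \<tau>) (answer M)"

lemma foldl_bind_pmf:
  "foldl (\<lambda>p u. bind_pmf p (\<lambda>m. f m u)) p \<tau> =
   bind_pmf p (\<lambda>m. foldl (\<lambda>p u. bind_pmf p (\<lambda>m. f m u)) (return_pmf m) \<tau>)"
proof (induction \<tau> rule: rev_induct)
  case Nil
  show ?case by (simp add: bind_return_pmf')
next
  case (snoc u \<tau>)
  show ?case
    unfolding foldl_append foldl.simps by (subst snoc.IH) (simp add: bind_assoc_pmf)
qed

text \<open>All coins are fresh, so the memory after \<open>\<sigma>\<close> is the only information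
  passed on to the rest of the run. It serves as the message of a one-way protocol whose receiver
  appends updates of its own choice.\<close>

lemma bind_memory_after_append:
  "bind_pmf (memory_after M (\<sigma> @ \<tau>)) (answer M) = bind_pmf (memory_after M \<sigma>) (continue M \<tau>)"
  unfolding memory_after_def foldl_append continue_def
  by (subst foldl_bind_pmf) (simp add: bind_assoc_pmf)

text \<open>The order of the updates depends on the set alone. Hence two permutations that yield the
  same sets of hyperedges yield literally the same stream.\<close>

definition canonical_list :: "'a set \<Rightarrow> 'a list" where
  "canonical_list X = (SOME xs. set xs = X \<and> distinct xs)"

lemma canonical_list:
  assumes "finite X"
  shows "set (canonical_list X) = X" "distinct (canonical_list X)"
proof -
  have "set (canonical_list X) = X \<and> distinct (canonical_list X)"
    unfolding canonical_list_def using finite_distinct_list[OF assms] by (rule someI_ex)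
  then show "set (canonical_list X) = X" "distinct (canonical_list X)" by auto
qed

definition insertions :: "nat set set \<Rightarrow> update list" where
  "insertions X = map (\<lambda>e. (e, 1)) (canonical_list X)"

definition deletions :: "nat set set \<Rightarrow> update list" where
  "deletions X = map (\<lambda>e. (e, - 1)) (canonical_list X)"

lemma multiplicity_in_append:
  "multiplicity_in (\<sigma> @ \<tau>) e = multiplicity_in \<sigma> e + multiplicity_in \<tau> e"
  by (simp add: multiplicity_in_def)

lemma multiplicity_in_map_const:
  "distinct xs \<Longrightarrow> multiplicity_in (map (\<lambda>e. (e, d)) xs) e = (if e \<in> set xs then d else 0)"
  by (induction xs) (auto simp: multiplicity_in_def)

lemma bounded_deletion_stream_insertions_deletions:
  assumes X: "finite X" "X \<subseteq> hyperedges n r" and Y: "Y \<subseteq> X" "card Y \<le> k"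
  shows "bounded_deletion_stream n r k (insertions X @ deletions Y)"
proof -
  note cX = canonical_list[OF X(1)] and cY = canonical_list[OF finite_subset[OF Y(1) X(1)]]
  have "multiplicity_in (take t (insertions X @ deletions Y)) e \<in> {0, 1}" for t e
  proof (cases "t \<le> length (canonical_list X)")
    case True
    have "multiplicity_in (take t (insertions X @ deletions Y)) e =
        (if e \<in> set (take t (canonical_list X)) then 1 else 0)"
      using True cX by (simp add: insertions_def take_map multiplicity_in_map_const)
    then show ?thesis by simp
  next
    case False
    define s where "s = t - length (canonical_list X)"
    have "multiplicity_in (take t (insertions X @ deletions Y)) e =
        (if e \<in> X then 1 else 0) + (if e \<in> set (take s (canonical_list Y)) then - 1 else 0)"
      using False cX cY
      by (simp add: insertions_def deletions_def take_map multiplicity_in_append multiplicity_in_map_const s_def)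
    moreover have "e \<in> set (take s (canonical_list Y)) \<Longrightarrow> e \<in> X"
      using cY Y(1) by (auto dest: in_set_takeD)
    ultimately show ?thesis by auto
  qed
  moreover have "num_deletions (insertions X @ deletions Y) = card Y"
    using distinct_card[OF cY(2)] cY(1)
    by (simp add: num_deletions_def insertions_def deletions_def filter_map o_def)
  ultimately show ?thesis
    using cX cY X Y unfolding bounded_deletion_stream_def hyperedge_stream_def
    by (auto simp: insertions_def deletions_def)
qed

lemma resulting_hypergraph_insertions_deletions:
  assumes "finite X" "Y \<subseteq> X"
  shows "resulting_hypergraph (insertions X @ deletions Y) = (X - Y, \<lambda>_. 1)"
proof -
  note cX = canonical_list[OF assms(1)] and cY = canonical_list[OF finite_subset[OF assms(2,1)]]
  show ?thesis
    using assms(2) unfolding resulting_hypergraph_def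
    by (auto simp: insertions_def deletions_def multiplicity_in_append multiplicity_in_map_const cX cY
        split: if_splits)
qed

lemma insertions_deletions_empty: "insertions X @ deletions {} = insertions X"
  using canonical_list[of "{} :: nat set set"] by (simp add: deletions_def)

text \<open>Here \<open>\<epsilon> < 1\<close> enters: a cut of positive weight must keep positive
  weight, hence at least one hyperedge.\<close>

lemma cut_sparsifier_cut_nonempty:
  assumes sp: "cut_sparsifier n \<epsilon> (X, \<lambda>_. 1) H'" and eps: "\<epsilon> < 1" and S: "S \<subseteq> {..<n}"
    and fin: "finite X" and ne: "cut n X S \<noteq> {}"
  shows "cut n (fst H') S \<noteq> {}"
proof
  assume "cut n (fst H') S = {}"
  then have "cut_weight n H' S = 0" by (simp add: cut_weight_def)
  moreover have "cut_weight n (X, \<lambda>_. 1) S > 0"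
    using fin ne by (auto simp: cut_weight_def card_gt_0_iff cut_def)
  moreover have "(1 - \<epsilon>) * cut_weight n (X, \<lambda>_. 1) S \<le> cut_weight n H' S"
    using sp S by (simp add: cut_sparsifier_def)
  ultimately show False using eps by (simp add: mult_le_0_iff)
qed

lemma length_memory_le_space_usage:
  assumes "space_usage A n r k \<le> enat s" "bounded_deletion_stream n r k \<sigma>" "M \<in> set_pmf A"
    "m \<in> set_pmf (memory_after M \<sigma>)"
  shows "length m \<le> s"
proof -
  have "enat (length m) \<le> space_usage A n r k"
    unfolding space_usage_def using assms by (intro Sup_upper) blast
  then show ?thesis using assms(1) by (metis enat_ord_simps(1) order_trans)
qed

lemma card_bool_lists_le: "card {m :: bool list. length m \<le> s} \<le> 2 ^ (s + 1)"
proof (induction s)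
  case (Suc s)
  have "{m :: bool list. length m \<le> Suc s} = {m. length m \<le> s} \<union> {m. length m = Suc s}" by auto
  moreover have "card {m :: bool list. length m = Suc s} = 2 ^ Suc s"
    using card_lists_length_eq[of "UNIV :: bool set" "Suc s"] by simp
  ultimately show ?case
    using Suc card_Un_le[of "{m :: bool list. length m \<le> s}" "{m :: bool list. length m = Suc s}"] by simp
qed simp

text \<open>With zero bits the memory is always the empty list, so the empty hypergraph and the one
  with the single hyperedge \<open>{0, 1}\<close> give the same output distribution. No output is
  correct for both, yet each set of correct outputs would have probability at least
  \<open>2 / 3\<close>.\<close>

lemma space_usage_pos:
  assumes prod: "produces_cut_sparsifiers A n r k \<epsilon>" and n: "n \<ge> 2" and r: "r \<ge> 2" and eps: "\<epsilon> < 1"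
  shows "1 \<le> space_usage A n r k"
proof (rule ccontr)
  assume "\<not> ?thesis"
  then have s0: "space_usage A n r k \<le> enat 0"
    by (cases "space_usage A n r k") (auto simp: one_enat_def)
  let ?e = "{0, 1} :: nat set"
  define \<sigma> where "\<sigma> X = insertions X @ deletions {}" for X
  have stream: "bounded_deletion_stream n r k (\<sigma> X)" if "X \<in> {{}, {?e}}" for X
    unfolding \<sigma>_def using that n r
    by (intro bounded_deletion_stream_insertions_deletions) (auto simp: hyperedges_def card_insert_if)
  have "memory_after M (\<sigma> X) = return_pmf []" if "M \<in> set_pmf A" "X \<in> {{}, {?e}}" for M X
  proof -
    have "set_pmf (memory_after M (\<sigma> X)) \<subseteq> {[]}"
      using length_memory_le_space_usage[OF s0 stream[OF that(2)] that(1)] by auto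
    then show ?thesis by (simp add: set_pmf_subset_singleton)
  qed
  then have out: "output_of A (\<sigma> {}) = output_of A (\<sigma> {?e})"
    unfolding output_of_def by (intro bind_pmf_cong) auto
  define Q where "Q X = {H'. cut_sparsifier n \<epsilon> (X, \<lambda>_. 1) H'}" for X
  have prob: "2 / 3 \<le> measure_pmf.prob (output_of A (\<sigma> X)) (Q X)" if "X \<in> {{}, {?e}}" for X
    using prod stream[OF that] that resulting_hypergraph_insertions_deletions[of X "{}"]
    by (auto simp: produces_cut_sparsifiers_def Q_def \<sigma>_def)
  have disj: "Q {} \<inter> Q {?e} = {}"
  proof (rule ccontr)
    assume "Q {} \<inter> Q {?e} \<noteq> {}"
    then obtain H' where H': "H' \<in> Q {}" "H' \<in> Q {?e}" by auto
    have "cut n {?e} {0} \<noteq> {}" using n by (auto simp: cut_def)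
    then have "cut n (fst H') {0} \<noteq> {}"
      using H'(2) eps n by (intro cut_sparsifier_cut_nonempty[of n \<epsilon> "{?e}"]) (auto simp: Q_def)
    then show False using H'(1) by (auto simp: Q_def cut_sparsifier_def cut_def)
  qed
  have "2 / 3 + 2 / 3 \<le> measure_pmf.prob (output_of A (\<sigma> {})) (Q {} \<union> Q {?e})"
    using prob[of "{}"] prob[of "{?e}"] out disj
    by (subst measure_pmf.finite_measure_Union) auto
  also have "\<dots> \<le> 1" by simp
  finally show False by simp
qed

section \<open>The hard instances\<close>

text \<open>Level \<open>t\<close> has \<open>4 ^ (L - 1 - t)\<close> slots. The sum from
  \<open>l = 0\<close> limits the number of deletions; for general \<open>l\<close> it shows that
  level \<open>l\<close> makes up more than three quarters of the levels from \<open>l\<close>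
  on.\<close>

lemma geometric_level_sum:
  "l \<le> L \<Longrightarrow> 3 * (\<Sum>t = l..<L. 4 ^ (L - 1 - t)) + 1 = (4::nat) ^ (L - l)"
proof (induction l rule: inc_induct)
  case (step l)
  have "(\<Sum>t = l..<L. 4 ^ (L - 1 - t)) = (4::nat) ^ (L - 1 - l) + (\<Sum>t = Suc l..<L. 4 ^ (L - 1 - t))"
    using step.hyps by (subst sum.atLeast_Suc_lessThan) auto
  moreover have "(4::nat) ^ (L - l) = 4 * 4 ^ (L - 1 - l)" "(4::nat) ^ (L - Suc l) = 4 ^ (L - 1 - l)"
    using step.hyps by (simp_all flip: power_Suc add: Suc_diff_Suc)
  ultimately show ?case using step.IH by linarith
qed simp

text \<open>Position \<open>i\<close> of a word belongs to vertex \<open>i div L\<close> and to level \<open>i mod L\<close>; its symbol \<open>a\<close> is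
  represented by \<open>4 ^ (L - 1 - i mod L)\<close> slots \<open>(i, a, j)\<close>, so a level outweighs all later levels of
  the same vertex together.\<close>

locale hard_instance =
  fixes n r k m h L q :: nat and edge :: "nat \<times> nat \<times> nat \<Rightarrow> nat set"
    and N :: nat and slots :: "(nat \<times> nat \<times> nat) set"
  defines "N \<equiv> h * L" and "slots \<equiv> {..<h * L} \<times> {..<q} \<times> {..<4 ^ L}"
  assumes L_pos: "L \<ge> 1" and q_pos: "q \<ge> 1" and L_le: "4 ^ L \<le> k" and h_le: "m + h \<le> n"
    and inj_edge: "inj_on edge slots"
    and edge_hyperedge: "x \<in> slots \<Longrightarrow> edge x \<in> hyperedges n r"
    and vertex_in_edge: "x \<in> slots \<Longrightarrow> v < h \<Longrightarrow> m + v \<in> edge x \<longleftrightarrow> v = fst x div L"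
    and edge_crosses: "x \<in> slots \<Longrightarrow> edge x \<inter> ({..<n} - {m + fst x div L}) \<noteq> {}"
begin

section \<open>Slots, levels and the decoder\<close>

definition occupied :: "nat list \<Rightarrow> nat \<Rightarrow> (nat \<times> nat \<times> nat) set" where
  "occupied z i = (\<lambda>j. (i, z ! i, j)) ` {..<4 ^ (L - 1 - i mod L)}"

definition all_occupied :: "nat list \<Rightarrow> (nat \<times> nat \<times> nat) set" where
  "all_occupied z = (\<Union>i<N. occupied z i)"

text \<open>Only earlier positions of the same vertex are deleted, so the count does not grow with
  \<open>h\<close>, and only symbols that the predictor for position \<open>i\<close> already knows
  are involved.\<close>

definition dead :: "nat list \<Rightarrow> nat \<Rightarrow> (nat \<times> nat \<times> nat) set" where
  "dead z i = (\<Union>i' \<in> {i'. i' < i \<and> i' div L = i div L}. occupied z i')"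

definition alive :: "nat list \<Rightarrow> nat \<Rightarrow> (nat \<times> nat \<times> nat) set" where
  "alive z i = (\<Union>i' \<in> {i'. i \<le> i' \<and> i' < N \<and> i' div L = i div L}. occupied z i')"

text \<open>Slots keep their vertex but may change level and symbol, so the name of a hyperedge
  reveals its vertex and hides its level.\<close>

definition vertex_perms :: "(nat \<times> nat \<times> nat \<Rightarrow> nat \<times> nat \<times> nat) set" where
  "vertex_perms = {\<pi>. \<pi> permutes slots \<and> (\<forall>x \<in> slots. fst (\<pi> x) div L = fst x div L)}"

definition stream :: "nat list \<Rightarrow> (nat \<times> nat \<times> nat \<Rightarrow> nat \<times> nat \<times> nat) \<Rightarrow> nat \<Rightarrow> update list" where
  "stream z \<pi> i = insertions (edge ` \<pi> ` all_occupied z) @ deletions (edge ` \<pi> ` dead z i)"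

text \<open>The choice depends on the output and the vertex but not on the permutation, as the
  symmetry argument requires.\<close>

definition picked_edge :: "nat \<Rightarrow> whypergraph \<Rightarrow> nat set" where
  "picked_edge i H' = (SOME e. e \<in> cut n (fst H') {m + i div L})"

definition hit :: "machine \<Rightarrow> nat list \<Rightarrow> (nat \<times> nat \<times> nat \<Rightarrow> nat \<times> nat \<times> nat) \<Rightarrow> nat \<Rightarrow>
    nat \<times> nat \<times> nat \<Rightarrow> real" where
  "hit M z \<pi> i x = measure_pmf.prob (bind_pmf (memory_after M (stream z \<pi> i)) (answer M))
     {H'. picked_edge i H' = edge (\<pi> x)}"

text \<open>The decoder: the queried position is \<open>length ys\<close>, so nothing of the word is
  used beyond the prefix. It carries out the deletions from the given memory, picks a hyperedge of
  the output, translates it back to a slot and reads the symbol there.\<close>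

definition guess :: "machine \<Rightarrow> (nat \<times> nat \<times> nat \<Rightarrow> nat \<times> nat \<times> nat) \<Rightarrow> bool list \<Rightarrow>
    nat list \<Rightarrow> nat \<Rightarrow> real" where
  "guess M \<pi> mem ys a =
     measure_pmf.prob (continue M (deletions (edge ` \<pi> ` dead ys (length ys))) mem)
       {H'. fst (snd (inv_into slots (edge \<circ> \<pi>) (picked_edge (length ys) H'))) = a}"

lemma finite_slots: "finite slots"
  by (simp add: slots_def)

lemma finite_vertex_perms: "finite vertex_perms"
  using finite_permutations[OF finite_slots] by (rule rev_finite_subset) (auto simp: vertex_perms_def)

lemma vertex_perms_nonempty: "vertex_perms \<noteq> {}"
  by (auto simp: vertex_perms_def intro!: exI[of _ id] permutes_id)

lemma occupied_subset_slots:
  assumes "z \<in> words q N" "i < N"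
  shows "occupied z i \<subseteq> slots"
proof -
  have "z ! i < q" using assms by (auto dest: nth_mem)
  moreover have "j < 4 ^ L" if "j < 4 ^ (L - 1 - i mod L)" for j :: nat
    using that power_increasing[of "L - 1 - i mod L" L "4::nat"] by linarith
  ultimately show ?thesis using assms by (auto simp: occupied_def slots_def N_def)
qed

lemma card_occupied: "card (occupied z i) = 4 ^ (L - 1 - i mod L)"
  unfolding occupied_def by (subst card_image) (auto simp: inj_on_def)

lemma all_occupied_subset_slots: "z \<in> words q N \<Longrightarrow> all_occupied z \<subseteq> slots"
  using occupied_subset_slots by (auto simp: all_occupied_def)

lemma alive_subset: "alive z i \<subseteq> all_occupied z"
  by (auto simp: alive_def all_occupied_def)

lemma dead_subset: "i < N \<Longrightarrow> dead z i \<subseteq> all_occupied z"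
  by (force simp: dead_def all_occupied_def)

lemma occupied_subset_alive: "i < N \<Longrightarrow> occupied z i \<subseteq> alive z i"
  by (auto simp: alive_def)

lemma alive_dead_disjoint: "alive z i \<inter> dead z i = {}"
  by (auto simp: alive_def dead_def occupied_def)

lemma alive_eq:
  assumes "i < N"
  shows "alive z i = {x \<in> all_occupied z - dead z i. fst x div L = i div L}"
proof -
  have "x \<in> alive z i" if "x \<in> all_occupied z" "x \<notin> dead z i" "fst x div L = i div L" for x
  proof -
    obtain i' where i': "i' < N" "x \<in> occupied z i'" using \<open>x \<in> all_occupied z\<close> by (auto simp: all_occupied_def)
    then have "i' div L = i div L" using \<open>fst x div L = i div L\<close> by (auto simp: occupied_def)
    moreover from this have "i \<le> i'" using i' \<open>x \<notin> dead z i\<close> by (auto simp: dead_def not_less)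
    ultimately show ?thesis using i' by (auto simp: alive_def)
  qed
  moreover have "fst x div L = i div L" if "x \<in> alive z i" for x
    using that by (auto simp: alive_def occupied_def)
  ultimately show ?thesis using alive_subset alive_dead_disjoint by blast
qed

text \<open>A common bound for \<open>dead\<close> and \<open>alive\<close>: the positions of vertex
  \<open>b\<close> are \<open>b * L + t\<close>, and level \<open>t\<close> contributes its own
  number of slots.\<close>

lemma card_UN_occupied_le:
  assumes "I \<subseteq> (\<lambda>t. b * L + t) ` T" "T \<subseteq> {..<L}"
  shows "card (\<Union>i\<in>I. occupied z i) \<le> (\<Sum>t\<in>T. 4 ^ (L - 1 - t))"
proof -
  have finT: "finite T" using assms(2) finite_subset by blast
  have "card (\<Union>i\<in>I. occupied z i) \<le> (\<Sum>i\<in>I. card (occupied z i))"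
    using assms finT by (intro card_UN_le) (auto intro: finite_subset)
  also have "\<dots> \<le> (\<Sum>i \<in> (\<lambda>t. b * L + t) ` T. card (occupied z i))"
    using assms finT by (intro sum_mono2) auto
  also have "\<dots> = (\<Sum>t\<in>T. card (occupied z (b * L + t)))"
    by (subst sum.reindex) (auto simp: inj_on_def)
  also have "\<dots> = (\<Sum>t\<in>T. 4 ^ (L - 1 - t))"
    using assms(2) by (intro sum.cong) (auto simp: card_occupied)
  finally show ?thesis .
qed

lemma card_dead_le: "card (dead z i) \<le> k"
proof -
  have "{i'. i' < i \<and> i' div L = i div L} \<subseteq> (\<lambda>t. i div L * L + t) ` {0..<L}"
  proof
    fix i' assume "i' \<in> {i'. i' < i \<and> i' div L = i div L}"
    then show "i' \<in> (\<lambda>t. i div L * L + t) ` {0..<L}"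
      using L_pos div_mult_mod_eq[of i' L] by (intro image_eqI[of _ _ "i' mod L"]) auto
  qed
  then have "card (dead z i) \<le> (\<Sum>t = 0..<L. 4 ^ (L - 1 - t))"
    unfolding dead_def by (rule card_UN_occupied_le) auto
  then show ?thesis using geometric_level_sum[of 0 L] L_le by simp
qed

text \<open>The live slots at the vertex belong to levels \<open>i mod L\<close> and later; by the
  geometric sum they number less than \<open>4 / 3\<close> times the slots of level
  \<open>i mod L\<close>.\<close>

lemma card_alive_le: "3 * card (alive z i) \<le> 4 * card (occupied z i)"
proof -
  have "{i'. i \<le> i' \<and> i' < N \<and> i' div L = i div L} \<subseteq> (\<lambda>t. i div L * L + t) ` {i mod L..<L}"
  proof
    fix i' assume i': "i' \<in> {i'. i \<le> i' \<and> i' < N \<and> i' div L = i div L}"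
    then have "i div L * L + i mod L \<le> i div L * L + i' mod L"
      by (metis (mono_tags, lifting) div_mult_mod_eq mem_Collect_eq)
    then have "i mod L \<le> i' mod L" by (rule add_le_imp_le_left)
    then show "i' \<in> (\<lambda>t. i div L * L + t) ` {i mod L..<L}"
      using L_pos i' div_mult_mod_eq[of i' L] by (intro image_eqI[of _ _ "i' mod L"]) auto
  qed
  then have "card (alive z i) \<le> (\<Sum>t = i mod L..<L. 4 ^ (L - 1 - t))"
    unfolding alive_def by (rule card_UN_occupied_le) auto
  moreover have lt: "i mod L < L" using L_pos by simp
  ultimately have "3 * card (alive z i) \<le> 4 ^ (L - i mod L)"
    using geometric_level_sum[of "i mod L" L] by simp
  also have "\<dots> = 4 * 4 ^ (L - 1 - i mod L)"
    using lt by (simp flip: power_Suc add: Suc_diff_Suc)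
  finally show ?thesis by (simp add: card_occupied)
qed

text \<open>The prefix alone determines the deletions, so the decoder can perform them.\<close>

lemma dead_take: "i < length z \<Longrightarrow> dead (take i z) i = dead z i"
  by (auto simp: dead_def occupied_def)

lemma vertex_perms_in_slots:
  "\<pi> \<in> vertex_perms \<Longrightarrow> x \<in> slots \<Longrightarrow> \<pi> x \<in> slots"
  by (simp add: vertex_perms_def permutes_in_image)

lemma inj_on_edge_perm: "\<pi> \<in> vertex_perms \<Longrightarrow> inj_on (edge \<circ> \<pi>) slots"
  by (auto simp: vertex_perms_def permutes_image permutes_inj_on inj_edge intro!: comp_inj_on)

section \<open>The streams and the cut at an upper vertex\<close>

lemma stream_bounded:
  assumes "z \<in> words q N" "\<pi> \<in> vertex_perms" "i < N"
  shows "bounded_deletion_stream n r k (stream z \<pi> i)"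
  unfolding stream_def
proof (rule bounded_deletion_stream_insertions_deletions)
  note sub = all_occupied_subset_slots[OF assms(1)]
  show "finite (edge ` \<pi> ` all_occupied z)" using sub finite_slots finite_subset by blast
  show "edge ` \<pi> ` all_occupied z \<subseteq> hyperedges n r"
    using sub vertex_perms_in_slots[OF assms(2)] edge_hyperedge by blast
  show "edge ` \<pi> ` dead z i \<subseteq> edge ` \<pi> ` all_occupied z" using dead_subset[OF assms(3)] by blast
  have "finite (dead z i)" using dead_subset[OF assms(3)] sub finite_slots by (meson finite_subset)
  then show "card (edge ` \<pi> ` dead z i) \<le> k"
    using card_dead_le[of z i] by (meson card_image_le finite_imageI order_trans)
qed

lemma resulting_hypergraph_stream:
  assumes "z \<in> words q N" "\<pi> \<in> vertex_perms" "i < N"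
  shows "resulting_hypergraph (stream z \<pi> i) = ((edge \<circ> \<pi>) ` (all_occupied z - dead z i), \<lambda>_. 1)"
proof -
  note sub = all_occupied_subset_slots[OF assms(1)] and dsub = dead_subset[OF assms(3), of z]
  have "finite (edge ` \<pi> ` all_occupied z)" using sub finite_slots finite_subset by blast
  moreover have "edge ` \<pi> ` dead z i \<subseteq> edge ` \<pi> ` all_occupied z" using dsub by blast
  ultimately have "resulting_hypergraph (stream z \<pi> i) =
      ((edge \<circ> \<pi>) ` all_occupied z - (edge \<circ> \<pi>) ` dead z i, \<lambda>_. 1)"
    unfolding stream_def by (simp add: resulting_hypergraph_insertions_deletions image_comp)
  also have "(edge \<circ> \<pi>) ` all_occupied z - (edge \<circ> \<pi>) ` dead z i = (edge \<circ> \<pi>) ` (all_occupied z - dead z i)"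
    using inj_on_edge_perm[OF assms(2)] sub dsub by (subst inj_on_image_set_diff[of _ slots]) auto
  finally show ?thesis .
qed

text \<open>The hyperedge of a slot contains exactly one of the upper vertices, that of its
  position, and at least one further vertex. Permutations preserve the vertex, so cutting off one
  upper vertex isolates precisely its live hyperedges.\<close>

lemma cut_stream:
  assumes "z \<in> words q N" "\<pi> \<in> vertex_perms" "i < N"
  shows "cut n ((edge \<circ> \<pi>) ` (all_occupied z - dead z i)) {m + i div L} = (edge \<circ> \<pi>) ` alive z i"
proof -
  have v: "i div L < h" using assms(3) by (simp add: N_def less_mult_imp_div_less)
  have "edge (\<pi> x) \<inter> {m + i div L} \<noteq> {} \<and> edge (\<pi> x) \<inter> ({..<n} - {m + i div L}) \<noteq> {}
      \<longleftrightarrow> fst x div L = i div L" if "x \<in> all_occupied z" for x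
  proof -
    have x: "x \<in> slots" using that all_occupied_subset_slots[OF assms(1)] by blast
    have \<pi>x: "\<pi> x \<in> slots" by (rule vertex_perms_in_slots[OF assms(2) x])
    have eq: "fst (\<pi> x) div L = fst x div L" using assms(2) x by (simp add: vertex_perms_def)
    have "edge (\<pi> x) \<inter> {m + i div L} \<noteq> {} \<longleftrightarrow> i div L = fst x div L"
      using vertex_in_edge[OF \<pi>x v] by (simp add: eq)
    moreover have "edge (\<pi> x) \<inter> ({..<n} - {m + fst x div L}) \<noteq> {}"
      using edge_crosses[OF \<pi>x] by (simp only: eq not_False_eq_True)
    ultimately show ?thesis by metis
  qed
  then show ?thesis unfolding cut_def alive_eq[OF assms(3)] by force
qed

text \<open>Exchanging two live slots changes neither the inserted nor the deleted set of hyperedges, so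
  averaged over all permutations every live slot is hit equally often.\<close>

lemma sum_hit_eq:
  assumes z: "z \<in> words q N" and i: "i < N" and x: "x \<in> alive z i" and y: "y \<in> alive z i"
  shows "(\<Sum>\<pi>\<in>vertex_perms. hit M z \<pi> i x) = (\<Sum>\<pi>\<in>vertex_perms. hit M z \<pi> i y)"
proof -
  define \<rho> where "\<rho> = Transposition.transpose x y"
  have xy: "x \<in> slots" "y \<in> slots" "fst x div L = fst y div L"
    using x y alive_subset[of z i] all_occupied_subset_slots[OF z] by (auto simp: alive_eq[OF i])
  have \<rho>: "\<rho> permutes slots" unfolding \<rho>_def using xy by (intro permutes_swap_id)
  have \<rho>_vertex: "fst (\<rho> w) div L = fst w div L" for w
    using xy(3) by (simp add: \<rho>_def Transposition.transpose_def)
  have closed: "\<pi> \<circ> \<rho> \<in> vertex_perms" if "\<pi> \<in> vertex_perms" for \<pi>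
    using that \<rho> \<rho>_vertex by (auto simp: vertex_perms_def permutes_compose permutes_in_image)
  have invol: "\<pi> \<circ> \<rho> \<circ> \<rho> = \<pi>" for \<pi> :: "nat \<times> nat \<times> nat \<Rightarrow> nat \<times> nat \<times> nat"
    by (simp add: \<rho>_def fun_eq_iff)
  have \<rho>_image: "\<rho> ` B = B" if "x \<in> B \<longleftrightarrow> y \<in> B" for B
    using that by (simp add: \<rho>_def transpose_image_eq)
  have "\<rho> ` all_occupied z = all_occupied z" "\<rho> ` dead z i = dead z i"
    using x y alive_subset[of z i] alive_dead_disjoint[of z i] by (auto intro!: \<rho>_image)
  then have stream_eq: "stream z (\<pi> \<circ> \<rho>) i = stream z \<pi> i" for \<pi>
    unfolding stream_def image_comp[symmetric] by simp
  have "(\<Sum>\<pi>\<in>vertex_perms. hit M z \<pi> i x) = (\<Sum>\<pi>\<in>vertex_perms. hit M z (\<pi> \<circ> \<rho>) i x)"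
    by (rule sum.reindex_bij_witness[of _ "\<lambda>\<pi>. \<pi> \<circ> \<rho>" "\<lambda>\<pi>. \<pi> \<circ> \<rho>"]) (simp_all add: closed invol)
  also have "\<dots> = (\<Sum>\<pi>\<in>vertex_perms. hit M z \<pi> i y)"
    by (simp add: hit_def stream_eq) (simp add: \<rho>_def)
  finally show ?thesis .
qed

text \<open>All live slots share the same total \<open>c\<close>, so the portion of hits in the
  level of \<open>i\<close> equals its portion of the live slots, at least
  \<open>3 / 4\<close>.\<close>

lemma sum_hit_alive_le:
  assumes z: "z \<in> words q N" and i: "i < N"
  shows "3 / 4 * (\<Sum>x \<in> alive z i. \<Sum>\<pi>\<in>vertex_perms. hit M z \<pi> i x)
    \<le> (\<Sum>x \<in> occupied z i. \<Sum>\<pi>\<in>vertex_perms. hit M z \<pi> i x)"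
proof -
  define x0 where "x0 = (i, z ! i, 0 :: nat)"
  define c where "c = (\<Sum>\<pi>\<in>vertex_perms. hit M z \<pi> i x0)"
  have "x0 \<in> alive z i"
    using occupied_subset_alive[OF i, of z] by (auto simp: x0_def occupied_def)
  then have c: "(\<Sum>\<pi>\<in>vertex_perms. hit M z \<pi> i x) = c" if "x \<in> alive z i" for x
    unfolding c_def using sum_hit_eq[OF z i that] by blast
  have "c \<ge> 0" by (auto simp: c_def hit_def intro!: sum_nonneg)
  moreover have "3 / 4 * real (card (alive z i)) \<le> real (card (occupied z i))"
    using card_alive_le[of z i] by linarith
  ultimately have "3 / 4 * real (card (alive z i)) * c \<le> real (card (occupied z i)) * c"
    by (intro mult_right_mono)
  moreover have "(\<Sum>x \<in> alive z i. \<Sum>\<pi>\<in>vertex_perms. hit M z \<pi> i x) = real (card (alive z i)) * c"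
    by (simp add: c)
  moreover have "(\<Sum>x \<in> occupied z i. \<Sum>\<pi>\<in>vertex_perms. hit M z \<pi> i x) = real (card (occupied z i)) * c"
    using occupied_subset_alive[OF i, of z] by (simp add: c subset_eq)
  ultimately show ?thesis by simp
qed

text \<open>A correct output keeps a hyperedge across the cut at the vertex of \<open>i\<close>, and
  as a sub-hypergraph it can only keep a live one. A union bound over the live slots
  finishes.\<close>

lemma prob_sparsifier_le_sum_hit:
  assumes z: "z \<in> words q N" and \<pi>: "\<pi> \<in> vertex_perms" and i: "i < N" and eps: "\<epsilon> < 1"
  shows "measure_pmf.prob (bind_pmf (memory_after M (stream z \<pi> i)) (answer M))
      {H'. cut_sparsifier n \<epsilon> (resulting_hypergraph (stream z \<pi> i)) H'}
    \<le> (\<Sum>x \<in> alive z i. hit M z \<pi> i x)"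
proof -
  let ?X = "(edge \<circ> \<pi>) ` (all_occupied z - dead z i)" and ?v = "m + i div L"
  have fin: "finite (all_occupied z)"
    using all_occupied_subset_slots[OF z] finite_slots finite_subset by blast
  have finA: "finite (alive z i)" using fin alive_subset finite_subset by blast
  have v: "{?v} \<subseteq> {..<n}"
    using i h_le less_mult_imp_div_less[of i h L] by (auto simp: N_def)
  have "card (occupied z i) > 0" by (simp add: card_occupied)
  then have ne: "cut n ?X {?v} \<noteq> {}"
    using occupied_subset_alive[OF i, of z] by (force simp only: cut_stream[OF z \<pi> i] card_gt_0_iff)
  have "picked_edge i H' \<in> (edge \<circ> \<pi>) ` alive z i" if sp: "cut_sparsifier n \<epsilon> (?X, \<lambda>_. 1) H'" for H'
  proof -
    have "\<exists>e. e \<in> cut n (fst H') {?v}"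
      using cut_sparsifier_cut_nonempty[OF sp eps v _ ne] fin by auto
    then have "picked_edge i H' \<in> cut n (fst H') {?v}"
      unfolding picked_edge_def by (rule someI_ex)
    moreover have "cut n (fst H') {?v} \<subseteq> cut n ?X {?v}"
      using sp by (auto simp: cut_sparsifier_def cut_def)
    ultimately show ?thesis using cut_stream[OF z \<pi> i] by blast
  qed
  then have "{H'. cut_sparsifier n \<epsilon> (resulting_hypergraph (stream z \<pi> i)) H'}
      \<subseteq> (\<Union>x \<in> alive z i. {H'. picked_edge i H' = edge (\<pi> x)})"
    unfolding resulting_hypergraph_stream[OF z \<pi> i] by fastforce
  then have "measure_pmf.prob (bind_pmf (memory_after M (stream z \<pi> i)) (answer M))
      {H'. cut_sparsifier n \<epsilon> (resulting_hypergraph (stream z \<pi> i)) H'}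
    \<le> measure_pmf.prob (bind_pmf (memory_after M (stream z \<pi> i)) (answer M))
      (\<Union>x \<in> alive z i. {H'. picked_edge i H' = edge (\<pi> x)})"
    by (intro measure_pmf.finite_measure_mono) auto
  also have "\<dots> \<le> (\<Sum>x \<in> alive z i. hit M z \<pi> i x)"
    unfolding hit_def using finA by (intro measure_UNION_le) auto
  finally show ?thesis .
qed

text \<open>Hits on different slots are disjoint events because \<open>edge \<circ> \<pi>\<close> is
  injective. On each of them the inverse returns a slot of position \<open>i\<close>, which carries
  the symbol \<open>z ! i\<close>.\<close>

lemma sum_hit_le_guess:
  assumes z: "z \<in> words q N" and \<pi>: "\<pi> \<in> vertex_perms" and i: "i < N"
  shows "(\<Sum>x \<in> occupied z i. hit M z \<pi> i x) \<le>
    measure_pmf.expectation (memory_after M (insertions (edge ` \<pi> ` all_occupied z)))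
      (\<lambda>mem. guess M \<pi> mem (take i z) (z ! i))"
proof -
  let ?P = "bind_pmf (memory_after M (stream z \<pi> i)) (answer M)"
  have sub: "occupied z i \<subseteq> slots" by (rule occupied_subset_slots[OF z i])
  note inj = inj_on_edge_perm[OF \<pi>]
  have "(\<Sum>x \<in> occupied z i. hit M z \<pi> i x) =
      measure_pmf.prob ?P (\<Union>x \<in> occupied z i. {H'. picked_edge i H' = edge (\<pi> x)})"
    unfolding hit_def using inj_on_subset[OF inj sub]
    by (intro measure_pmf.finite_measure_finite_Union[symmetric])
       (auto simp: occupied_def disjoint_family_on_def inj_on_def)
  also have "\<dots> \<le> measure_pmf.prob ?P
      {H'. fst (snd (inv_into slots (edge \<circ> \<pi>) (picked_edge i H'))) = z ! i}"
  proof (intro measure_pmf.finite_measure_mono subsetI)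
    fix H' assume "H' \<in> (\<Union>x \<in> occupied z i. {H'. picked_edge i H' = edge (\<pi> x)})"
    then obtain x where x: "x \<in> occupied z i" "picked_edge i H' = (edge \<circ> \<pi>) x" by auto
    then have "inv_into slots (edge \<circ> \<pi>) (picked_edge i H') = x"
      using sub inv_into_f_f[OF inj, of x] by auto
    then show "H' \<in> {H'. fst (snd (inv_into slots (edge \<circ> \<pi>) (picked_edge i H'))) = z ! i}"
      using x(1) by (auto simp: occupied_def)
  qed simp
  also have "\<dots> = measure_pmf.expectation (memory_after M (insertions (edge ` \<pi> ` all_occupied z)))
      (\<lambda>mem. guess M \<pi> mem (take i z) (z ! i))"
  proof -
    have "min (length z) i = i" "i < length z" using z i by auto
    then show ?thesis
      unfolding stream_def bind_memory_after_append measure_bind_pmf guess_def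
      by (simp add: dead_take)
  qed
  finally show ?thesis .
qed

lemma sum_guess_le_1: "(\<Sum>a<q. guess M \<pi> mem ys a) \<le> 1"
proof -
  have "(\<Sum>a<q. guess M \<pi> mem ys a) =
      measure_pmf.prob (continue M (deletions (edge ` \<pi> ` dead ys (length ys))) mem)
       (\<Union>a<q. {H'. fst (snd (inv_into slots (edge \<circ> \<pi>) (picked_edge (length ys) H'))) = a})"
    unfolding guess_def
    by (intro measure_pmf.finite_measure_finite_Union[symmetric]) (auto simp: disjoint_family_on_def)
  then show ?thesis by simp
qed

theorem space_lower_bound:
  assumes prod: "produces_cut_sparsifiers A n r k \<epsilon>" and eps: "\<epsilon> < 1"
    and space: "space_usage A n r k \<le> enat s"
  shows "real q powr (real N / 2) \<le> 2 ^ (s + 1) * 2 ^ N"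
proof -
  let ?Z = "words q N" and ?G = vertex_perms
  define succ where "succ M z \<pi> i = measure_pmf.prob (bind_pmf (memory_after M (stream z \<pi> i)) (answer M))
      {H'. cut_sparsifier n \<epsilon> (resulting_hypergraph (stream z \<pi> i)) H'}" for M z \<pi> i
  define F where "F M = (\<Sum>z\<in>?Z. \<Sum>i<N. \<Sum>\<pi>\<in>?G. succ M z \<pi> i)" for M
  have cardZ: "real (card ?Z) = real q ^ N" by (simp add: card_lists_length_eq)
  have int: "integrable (measure_pmf A) (\<lambda>M. succ M z \<pi> i)" for z \<pi> i
    by (intro measure_pmf.integrable_const_bound[where B = 1]) (auto simp: succ_def)
  have intF: "integrable (measure_pmf A) F"
    unfolding F_def using int by simp
  have "2 / 3 * real (card ?G) * real N * real q ^ N = (\<Sum>z\<in>?Z. \<Sum>i<N. \<Sum>\<pi>\<in>?G. 2 / 3)"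
    by (simp add: cardZ)
  also have "\<dots> \<le> (\<Sum>z\<in>?Z. \<Sum>i<N. \<Sum>\<pi>\<in>?G. measure_pmf.expectation A (\<lambda>M. succ M z \<pi> i))"
  proof (intro sum_mono)
    fix z \<pi> i assume "z \<in> ?Z" "\<pi> \<in> ?G" "i \<in> {..<N}"
    then have "bounded_deletion_stream n r k (stream z \<pi> i)" by (intro stream_bounded) auto
    then show "2 / 3 \<le> measure_pmf.expectation A (\<lambda>M. succ M z \<pi> i)"
      using prod unfolding produces_cut_sparsifiers_def output_of_def succ_def
      by (simp add: measure_bind_pmf[of A])
  qed
  also have "\<dots> = measure_pmf.expectation A F"
    unfolding F_def using int by (simp add: Bochner_Integration.integral_sum)
  \<comment> \<open>The seed is fixed first, by averaging the success probability over all words,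
    positions and permutations together.\<close>
  finally obtain M where M: "M \<in> set_pmf A" and FM: "2 / 3 * real (card ?G) * real N * real q ^ N \<le> F M"
    using expectation_ge_imp_ex_set_pmf_ge[of A F] intF by blast
  have "real (card ?G) * (1 / 2 * real N * real q ^ N) \<le> 3 / 4 * F M" using FM by (simp add: mult_ac)
  also have "\<dots> = (\<Sum>z\<in>?Z. \<Sum>i<N. 3 / 4 * (\<Sum>\<pi>\<in>?G. succ M z \<pi> i))"
    by (simp add: F_def sum_distrib_left)
  also have "\<dots> \<le> (\<Sum>z\<in>?Z. \<Sum>i<N. \<Sum>\<pi>\<in>?G. \<Sum>x \<in> occupied z i. hit M z \<pi> i x)"
  proof (intro sum_mono)
    fix z i assume zi: "z \<in> ?Z" "i \<in> {..<N}"
    have "3 / 4 * (\<Sum>\<pi>\<in>?G. succ M z \<pi> i) \<le> 3 / 4 * (\<Sum>\<pi>\<in>?G. \<Sum>x \<in> alive z i. hit M z \<pi> i x)"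
      unfolding succ_def using zi eps
      by (intro mult_left_mono sum_mono prob_sparsifier_le_sum_hit) auto
    also have "\<dots> \<le> (\<Sum>\<pi>\<in>?G. \<Sum>x \<in> occupied z i. hit M z \<pi> i x)"
      using sum_hit_alive_le[of z i M] zi by (simp add: sum.swap[of _ _ ?G])
    finally show "3 / 4 * (\<Sum>\<pi>\<in>?G. succ M z \<pi> i) \<le> (\<Sum>\<pi>\<in>?G. \<Sum>x \<in> occupied z i. hit M z \<pi> i x)" .
  qed
  also have "\<dots> \<le> (\<Sum>z\<in>?Z. \<Sum>i<N. \<Sum>\<pi>\<in>?G.
      measure_pmf.expectation (memory_after M (insertions (edge ` \<pi> ` all_occupied z)))
        (\<lambda>mem. guess M \<pi> mem (take i z) (z ! i)))"
    by (intro sum_mono sum_hit_le_guess) auto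
  also have "\<dots> = (\<Sum>\<pi>\<in>?G. \<Sum>z\<in>?Z. \<Sum>i<N.
      measure_pmf.expectation (memory_after M (insertions (edge ` \<pi> ` all_occupied z)))
        (\<lambda>mem. guess M \<pi> mem (take i z) (z ! i)))" (is "_ = (\<Sum>\<pi>\<in>?G. ?E \<pi>)")
    by (simp add: sum.swap[of _ ?G])
  finally have "(\<Sum>\<pi>\<in>?G. 1 / 2 * real N * real q ^ N) \<le> (\<Sum>\<pi>\<in>?G. ?E \<pi>)" by simp
  \<comment> \<open>A good permutation is fixed as well. The memory then depends on the word and the
    coins of \<open>M\<close> only, and augmented indexing applies with
    \<open>p = 1 / 2\<close>.\<close>
  then obtain \<pi> where \<pi>: "\<pi> \<in> ?G" and E: "1 / 2 * real N * real q ^ N \<le> ?E \<pi>"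
    using sum_strict_mono[OF finite_vertex_perms vertex_perms_nonempty, of ?E "\<lambda>_. 1 / 2 * real N * real q ^ N"]
    by (meson not_le)
  have "real q powr (1 / 2 * real N) \<le> real (card {m :: bool list. length m \<le> s}) * 2 ^ N"
  proof (rule augmented_index_memory_bound[OF q_pos _ _ _ sum_guess_le_1 E])
    show "finite {m :: bool list. length m \<le> s}"
      using finite_lists_length_le[of "UNIV :: bool set" s] by simp
    fix z assume z: "z \<in> ?Z"
    have sub: "edge ` \<pi> ` all_occupied z \<subseteq> hyperedges n r" "finite (edge ` \<pi> ` all_occupied z)"
      using all_occupied_subset_slots[OF z] vertex_perms_in_slots[OF \<pi>] edge_hyperedge
        finite_subset[OF _ finite_slots] by blast+
    then have "bounded_deletion_stream n r k (insertions (edge ` \<pi> ` all_occupied z) @ deletions {})"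
      by (intro bounded_deletion_stream_insertions_deletions) auto
    then show "set_pmf (memory_after M (insertions (edge ` \<pi> ` all_occupied z))) \<subseteq> {m. length m \<le> s}"
      using length_memory_le_space_usage[OF space _ M] by (auto simp: insertions_deletions_empty)
  qed (simp add: guess_def)
  also have "\<dots> \<le> 2 ^ (s + 1) * 2 ^ N"
    using of_nat_mono[OF card_bool_lists_le[of s], where ?'a = real] by (intro mult_right_mono) simp_all
  finally show ?thesis by simp
qed

end

section \<open>Counting hyperedges\<close>

lemma finite_hyperedges: "finite (hyperedges n r)"
  by (rule finite_subset[of _ "Pow {..<n}"]) (auto simp: hyperedges_def)

lemma card_hyperedges_le_power: "card (hyperedges n r) \<le> 2 ^ n"
proof -
  have "card (hyperedges n r) \<le> card (Pow {..<n})"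
    by (intro card_mono) (auto simp: hyperedges_def)
  then show ?thesis by (simp add: card_Pow)
qed

lemma power_le_card_hyperedges:
  assumes "s \<le> m"
  shows "2 ^ s \<le> card (hyperedges m s)"
proof -
  have "Pow {..<s} \<subseteq> hyperedges m s"
    using assms by (fastforce simp: hyperedges_def dest: card_mono[rotated])
  then have "card (Pow {..<s}) \<le> card (hyperedges m s)" by (intro card_mono finite_hyperedges)
  then show ?thesis by (simp add: card_Pow)
qed

lemma Suc_le_card_hyperedges:
  assumes "s \<ge> 1"
  shows "m + 1 \<le> card (hyperedges m s)"
proof -
  have "insert {} ((\<lambda>x. {x}) ` {..<m}) \<subseteq> hyperedges m s"
    using assms by (auto simp: hyperedges_def)
  then have "card (insert {} ((\<lambda>x. {x}) ` {..<m})) \<le> card (hyperedges m s)"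
    by (intro card_mono finite_hyperedges)
  moreover have "card (insert {} ((\<lambda>x. {x}) ` {..<m})) = m + 1"
    by (subst card_insert_disjoint) (auto simp: card_image)
  ultimately show ?thesis by simp
qed

text \<open>Each such set arises from a smaller one by adding at most one vertex; the extra index
  \<open>m\<close> stands for adding none.\<close>

lemma card_hyperedges_Suc_arity: "card (hyperedges m (Suc s)) \<le> card (hyperedges m s) * (m + 1)"
proof -
  let ?f = "\<lambda>(T, x). if x < m then insert x T else T"
  have "hyperedges m (Suc s) \<subseteq> ?f ` (hyperedges m s \<times> {..<m + 1})"
  proof
    fix e assume e: "e \<in> hyperedges m (Suc s)"
    then have fin: "finite e" by (auto simp: hyperedges_def intro: finite_subset)
    show "e \<in> ?f ` (hyperedges m s \<times> {..<m + 1})"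
    proof (cases "e = {}")
      case True
      then show ?thesis by (intro image_eqI[of _ _ "({}, m)"]) (auto simp: hyperedges_def)
    next
      case False
      then obtain x where x: "x \<in> e" by auto
      then show ?thesis using e fin
        by (intro image_eqI[of _ _ "(e - {x}, x)"]) (auto simp: hyperedges_def card_Diff_singleton)
    qed
  qed
  then have "card (hyperedges m (Suc s)) \<le> card (hyperedges m s \<times> {..<m + 1})"
    using finite_hyperedges by (intro surj_card_le) auto
  then show ?thesis by (simp add: card_cartesian_product)
qed

lemma card_hyperedges_add: "card (hyperedges (m + m') r) \<le> card (hyperedges m r) * card (hyperedges m' r)"
proof -
  let ?f = "\<lambda>(A, B). A \<union> (\<lambda>x. m + x) ` B"
  have "hyperedges (m + m') r \<subseteq> ?f ` (hyperedges m r \<times> hyperedges m' r)"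
  proof
    fix e assume e: "e \<in> hyperedges (m + m') r"
    then have fin: "finite e" by (auto simp: hyperedges_def intro: finite_subset)
    define B where "B = (\<lambda>x. x - m) ` (e - {..<m})"
    have "card (e \<inter> {..<m}) \<le> card e" using fin by (intro card_mono) auto
    moreover have "card B \<le> card e" unfolding B_def
      using fin by (meson card_image_le card_mono Diff_subset finite_Diff order_trans)
    moreover have "B \<subseteq> {..<m'}" using e by (auto simp: B_def hyperedges_def)
    moreover have "e = (e \<inter> {..<m}) \<union> (\<lambda>x. m + x) ` B"
      by (auto simp: B_def image_image)
    ultimately show "e \<in> ?f ` (hyperedges m r \<times> hyperedges m' r)"
      using e by (intro image_eqI[of _ _ "(e \<inter> {..<m}, B)"]) (auto simp: hyperedges_def)
  qed
  then have "card (hyperedges (m + m') r) \<le> card (hyperedges m r \<times> hyperedges m' r)"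
    using finite_hyperedges by (intro surj_card_le) auto
  then show ?thesis by (simp add: card_cartesian_product)
qed

text \<open>Relates the largest admissible \<open>k\<close> to the supply of lower parts:
  \<open>log k\<close> is at most about four times the logarithm of their number \<open>P\<close>.
  Restoring the arity \<open>r\<close> costs a factor \<open>m + 1 \<le> P\<close>, two halves give
  \<open>P ^ 4\<close>, and a leftover vertex for odd \<open>n\<close> at most doubles this.\<close>

lemma card_hyperedges_le_half:
  assumes r: "r \<ge> 2"
  shows "card (hyperedges n r) \<le> 4 * card (hyperedges (n div 2) (r - 1)) ^ 4"
proof -
  define m where "m = n div 2"
  define P where "P = card (hyperedges m (r - 1))"
  have "card (hyperedges m (Suc (r - 1))) \<le> P * (m + 1)"
    unfolding P_def by (rule card_hyperedges_Suc_arity)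
  also have "\<dots> \<le> P * P"
    unfolding P_def using r by (intro mult_left_mono Suc_le_card_hyperedges) auto
  finally have half: "card (hyperedges m r) \<le> P * P" using r by simp
  have one: "card (hyperedges (n mod 2) r) \<le> 2"
  proof -
    have "(2::nat) ^ (n mod 2) \<le> 2 ^ 1" by (rule power_increasing) auto
    then show ?thesis using card_hyperedges_le_power[of "n mod 2" r] by simp
  qed
  have "card (hyperedges n r) = card (hyperedges ((m + m) + n mod 2) r)"
    by (simp add: m_def flip: mult_2)
  also have "\<dots> \<le> card (hyperedges (m + m) r) * card (hyperedges (n mod 2) r)"
    by (rule card_hyperedges_add)
  also have "\<dots> \<le> (card (hyperedges m r) * card (hyperedges m r)) * 2"
    by (intro mult_mono card_hyperedges_add one) auto
  also have "\<dots> \<le> ((P * P) * (P * P)) * 2"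
    by (intro mult_mono half) auto
  also have "\<dots> \<le> 4 * P ^ 4" by (simp add: power4_eq_xxxx)
  finally show ?thesis by (simp add: P_def m_def)
qed

section \<open>Choice of parameters and the final bound\<close>

lemma space_lower_bound_large:
  fixes n r k s :: nat
  assumes n: "n \<ge> 2 ^ 20" and r: "r \<ge> 2" "r - 1 \<le> n div 2" and k: "n < k" "k \<le> card (hyperedges n r)"
    and eps: "\<epsilon> < 1" and prod: "produces_cut_sparsifiers A n r k \<epsilon>"
    and space: "space_usage A n r k \<le> enat s"
  shows "real n * real r * log 2 (real k) \<le> 2 ^ 12 * real s"
proof -
  define m where "m = n div 2"
  define P where "P = card (hyperedges m (r - 1))"
  have P_m: "m + 1 \<le> P" unfolding P_def using r by (intro Suc_le_card_hyperedges) simp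
  then have P_pos: "P \<ge> 1" by simp
  have P_r: "2 ^ (r - 1) \<le> P" unfolding P_def m_def using r by (intro power_le_card_hyperedges)
  obtain u where u: "2 ^ u \<le> P" "P < 2 ^ (u + 1)"
    using ex_power_ivl1[of 2 P] P_pos by auto
  obtain t where t: "2 ^ t \<le> k" "k < 2 ^ (t + 1)"
    using ex_power_ivl1[of 2 k] k by auto
  have ru: "r - 1 \<le> u"
  proof -
    have "(2::nat) ^ (r - 1) < 2 ^ (u + 1)" using P_r u by linarith
    then show ?thesis by (simp add: power_strict_increasing_iff del: power_Suc)
  qed
  have u19: "19 \<le> u"
  proof -
    have "(2::nat) ^ 19 \<le> m" using n by (simp add: m_def)
    then have "(2::nat) ^ 19 < 2 ^ (u + 1)" using P_m u by linarith
    then have "19 < u + 1" by (rule power_less_imp_less_exp[rotated]) simp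
    then show ?thesis by simp
  qed
  have t20: "20 \<le> t"
  proof -
    have "(2::nat) ^ 20 < 2 ^ (t + 1)" using n k t by linarith
    then have "20 < t + 1" by (rule power_less_imp_less_exp[rotated]) simp
    then show ?thesis by simp
  qed
  have tu: "t < 4 * u + 6"
  proof -
    have "P ^ 4 < (2 ^ (u + 1)) ^ 4" using u by (intro power_strict_mono) auto
    also have "(2 ^ (u + 1)) ^ 4 = (2::nat) ^ (4 * u + 4)"
      unfolding power_mult[symmetric] by (rule arg_cong[where f = "power 2"]) simp
    finally have "4 * P ^ 4 < 4 * 2 ^ (4 * u + 4)" by simp
    moreover have "(4::nat) * 2 ^ (4 * u + 4) = 2 ^ (4 * u + 6)" by (simp add: power_add)
    moreover have "2 ^ t \<le> 4 * P ^ 4"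
      using t k card_hyperedges_le_half[OF r(1), of n] by (simp add: P_def m_def)
    ultimately have "(2::nat) ^ t < 2 ^ (4 * u + 6)" by linarith
    then show ?thesis by (rule power_less_imp_less_exp[rotated]) simp
  qed
  \<comment> \<open>The names needed per vertex must fit:
    \<open>L * 2 ^ b * 4 ^ L \<le> 2 ^ (b + 3 * L)\<close> has to stay within
    \<open>2 ^ (u - 1)\<close>. Dividing by 48 and by 4 makes \<open>3 * L\<close> and
    \<open>b\<close> each about \<open>u / 4\<close> at most, and \<open>19 \<le> u\<close> covers
    the additive constants.\<close>
  define L where "L = 1 + t div 48"
  define b where "b = 4 + r div 4"
  have bL: "b + 3 * L + 1 \<le> u" using ru u19 tu by (simp add: L_def b_def)
  have L_le: "4 ^ L \<le> k"
  proof -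
    have "2 * L \<le> t" using t20 by (simp add: L_def)
    then have "(2::nat) ^ (2 * L) \<le> 2 ^ t" by (intro power_increasing) auto
    then show ?thesis using t by (simp add: power_mult)
  qed
  \<comment> \<open>Without the empty set, every hyperedge has a vertex in the lower half and
    crosses the cut at its upper vertex.\<close>
  define U where "U = hyperedges m (r - 1) - {{}}"
  have finU: "finite U" by (simp add: U_def finite_hyperedges)
  have cardU: "card U = P - 1"
    by (simp add: U_def P_def card_Diff_singleton hyperedges_def)
  let ?I = "{..<L} \<times> {..<2 ^ b} \<times> {..<4 ^ L} :: (nat \<times> nat \<times> nat) set"
  have "card ?I \<le> card U"
  proof -
    have "card ?I = L * 2 ^ b * 2 ^ (2 * L)" by (simp add: card_cartesian_product power_mult)
    also have "\<dots> \<le> 2 ^ L * 2 ^ b * 2 ^ (2 * L)"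
      by (intro mult_right_mono) (auto intro: less_imp_le less_exp)
    also have "\<dots> = 2 ^ (b + 3 * L)" by (simp flip: power_add)
    also have "\<dots> \<le> 2 ^ (u - 1)" using bL by (intro power_increasing) auto
    also have "\<dots> \<le> P - 1"
    proof -
      have "2 * 2 ^ (u - 1) = (2::nat) ^ u" using u19 by (simp flip: power_Suc)
      moreover have "(1::nat) \<le> 2 ^ (u - 1)" by simp
      ultimately show ?thesis using u(1) by linarith
    qed
    finally show ?thesis by (simp add: cardU)
  qed
  then obtain \<iota> where \<iota>: "\<iota> ` ?I \<subseteq> U" "inj_on \<iota> ?I"
    using card_le_inj[of ?I U] finU by auto
  define h where "h = n - m"
  \<comment> \<open>The upper vertex is \<open>m + i div L\<close>; the lower part encodes level,
    symbol and index. All upper vertices reuse the same lower parts.\<close>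
  define edge where "edge = (\<lambda>(i, a, j). insert (m + i div L) (\<iota> (i mod L, a, j)))"
  have L_pos: "L \<ge> 1" by (simp add: L_def)
  let ?slots = "{..<h * L} \<times> {..<2 ^ b} \<times> {..<4 ^ L} :: (nat \<times> nat \<times> nat) set"
  have \<iota>U: "\<iota> (i mod L, a, j) \<subseteq> {..<m}" "\<iota> (i mod L, a, j) \<noteq> {}" "card (\<iota> (i mod L, a, j)) \<le> r - 1"
    if "(i, a, j) \<in> ?slots" for i a j
  proof -
    have "(i mod L, a, j) \<in> ?I" using that L_pos by auto
    then have "\<iota> (i mod L, a, j) \<in> U" using \<iota>(1) by blast
    then show "\<iota> (i mod L, a, j) \<subseteq> {..<m}" "\<iota> (i mod L, a, j) \<noteq> {}" "card (\<iota> (i mod L, a, j)) \<le> r - 1"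
      by (auto simp: U_def hyperedges_def)
  qed
  have mh: "m + h = n" by (simp add: h_def m_def)
  have vtx: "m + i div L < n" if "(i, a, j) \<in> ?slots" for i a j
    using that less_mult_imp_div_less[of i h L] mh by auto
  have inj: "inj_on edge ?slots"
  proof (rule inj_onI)
    fix x y assume xy: "x \<in> ?slots" "y \<in> ?slots" and eq: "edge x = edge y"
    obtain i a j i' a' j' where x: "x = (i, a, j)" and y: "y = (i', a', j')" by (cases x, cases y)
    note s = xy[unfolded x y]
    \<comment> \<open>The lower part of the hyperedge determines level, symbol and index; its upper
      vertex determines \<open>i div L\<close>.\<close>
    have "\<iota> (i mod L, a, j) = edge x \<inter> {..<m}" "\<iota> (i' mod L, a', j') = edge y \<inter> {..<m}"
      using \<iota>U(1)[OF s(1)] \<iota>U(1)[OF s(2)] by (auto simp: edge_def x y)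
    with eq have "\<iota> (i mod L, a, j) = \<iota> (i' mod L, a', j')" by simp
    with \<iota>(2) have e1: "(i mod L, a, j) = (i' mod L, a', j')"
      by (rule inj_onD) (use s L_pos in auto)
    have "m + i div L \<in> edge y" unfolding eq[symmetric] by (simp add: edge_def x)
    then have "i div L = i' div L" using \<iota>U(1)[OF s(2)] by (auto simp: edge_def y)
    with e1 have "i = i'" by (metis div_mult_mod_eq prod.inject)
    with e1 show "x = y" by (simp add: x y)
  qed
  have arity: "edge x \<in> hyperedges n r" if "x \<in> ?slots" for x
  proof -
    obtain i a j where x: "x = (i, a, j)" by (cases x)
    note s = that[unfolded x]
    have "card (insert (m + i div L) (\<iota> (i mod L, a, j))) \<le> r"
      using \<iota>U(3)[OF s] r by (intro card_insert_le_m1) auto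
    moreover have "insert (m + i div L) (\<iota> (i mod L, a, j)) \<subseteq> {..<n}"
      using \<iota>U(1)[OF s] vtx[OF s] mh by auto
    ultimately show ?thesis by (simp add: x edge_def hyperedges_def)
  qed
  have vertex: "m + v \<in> edge x \<longleftrightarrow> v = fst x div L" if "x \<in> ?slots" "v < h" for x v
  proof -
    obtain i a j where x: "x = (i, a, j)" by (cases x)
    show ?thesis using \<iota>U(1)[OF that(1)[unfolded x]] by (auto simp: x edge_def)
  qed
  have crosses: "edge x \<inter> ({..<n} - {m + fst x div L}) \<noteq> {}" if "x \<in> ?slots" for x
  proof -
    obtain i a j where x: "x = (i, a, j)" by (cases x)
    note s = that[unfolded x]
    obtain w where w: "w \<in> \<iota> (i mod L, a, j)" using \<iota>U(2)[OF s] by blast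
    then have "w < m" using \<iota>U(1)[OF s] by blast
    with w have "w \<in> edge x \<inter> ({..<n} - {m + fst x div L})" using mh by (auto simp: x edge_def)
    then show ?thesis by blast
  qed
  have q_pos: "1 \<le> (2::nat) ^ b" by simp
  interpret hard_instance n r k m h L "2 ^ b" edge "h * L" ?slots
    by (unfold_locales; rule L_pos q_pos L_le eq_imp_le[OF mh] inj arity vertex crosses; assumption)
  define N where "N = h * L"
  have "real (2 ^ b) powr (real N / 2) \<le> 2 ^ (s + 1) * 2 ^ N"
    unfolding N_def by (rule space_lower_bound[OF prod eps space])
  then have "2 powr (real b * (real N / 2)) \<le> 2 powr (real (s + 1) + real N)"
    by (simp add: powr_realpow[symmetric] powr_powr powr_add)
  then have main: "real b * (real N / 2) \<le> real s + 1 + real N" by simp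
  \<comment> \<open>Since \<open>b \<ge> 4\<close>, the loss \<open>2 ^ N\<close> of the indexing
    bound accounts for at most half of the exponent \<open>b * N / 2\<close>.\<close>
  have "real N * 4 \<le> real N * real b" by (intro mult_left_mono) (simp_all add: b_def)
  with main have Nb: "real N * real b \<le> 4 * (real s + 1)" by (simp add: mult_ac)
  have "n \<le> 2 * h" by (simp add: h_def m_def)
  then have "real n * real L * real b \<le> real (2 * h) * real L * real b"
    by (intro mult_right_mono) (simp_all flip: of_nat_mult)
  also have "\<dots> = 2 * (real N * real b)" by (simp add: N_def)
  finally have nLb: "real n * real L * real b \<le> 8 * (real s + 1)" using Nb by simp
  \<comment> \<open>The product is so large that \<open>s \<ge> 1\<close> follows, hence
    \<open>8 * (s + 1) \<le> 16 * s\<close>.\<close>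
  have "2 ^ 20 * 1 * 4 \<le> real n * real L * real b"
    using n L_pos by (intro mult_mono) (simp_all add: b_def)
  with nLb have s1: "real n * real L * real b \<le> 16 * real s" by simp
  have "real k \<le> real (2 ^ (t + 1))" using t(2) by (intro of_nat_mono less_imp_le)
  then have "log 2 (real k) \<le> log 2 (2 ^ (t + 1))" using k by (intro log_mono) auto
  also have "\<dots> = real (t + 1)" by (simp only: log_pow_cancel)
  also have "\<dots> \<le> real (48 * L)" unfolding of_nat_le_iff by (simp add: L_def)
  finally have logk: "log 2 (real k) \<le> 48 * real L" by simp
  have rb: "real r \<le> 4 * real b"
  proof -
    have "r \<le> 4 * b" by (simp add: b_def)
    then have "real r \<le> real (4 * b)" by (rule of_nat_mono)
    then show ?thesis by simp
  qed
  have "log 2 (real k) \<ge> 0" using k by simp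
  then have "real n * real r * log 2 (real k) \<le> real n * (4 * real b) * (48 * real L)"
    using logk rb by (intro mult_mono) auto
  also have "\<dots> = 192 * (real n * real L * real b)" by simp
  also have "\<dots> \<le> 192 * (16 * real s)" using s1 by (intro mult_left_mono) simp_all
  finally show ?thesis by simp
qed

theorem theorem1p3:
  "\<exists>c::real. c > 0 \<and>
     (\<forall>(n::nat) (r::nat) (k::nat) (\<epsilon>::real) (A::streaming_algorithm).
        n \<ge> 1 \<longrightarrow> r \<ge> 2 \<longrightarrow> k \<ge> 1 \<longrightarrow> real r \<le> real n / 2 + 1 \<longrightarrow> \<epsilon> < 1 \<longrightarrow>
        k \<le> card (hyperedges n r) \<longrightarrow>
        produces_cut_sparsifiers A n r k \<epsilon> \<longrightarrow>
        ereal (c * (real n * real r * log 2 (real k / real n)))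
          \<le> ereal_of_enat (space_usage A n r k))"
proof (intro exI[of _ "1 / 2 ^ 60 :: real"] conjI allI impI)
  fix n r k :: nat and \<epsilon> :: real and A :: streaming_algorithm
  assume n: "n \<ge> 1" and r: "r \<ge> 2" and k: "k \<ge> 1" and rn: "real r \<le> real n / 2 + 1" and eps: "\<epsilon> < 1"
    and kc: "k \<le> card (hyperedges n r)" and prod: "produces_cut_sparsifiers A n r k \<epsilon>"
  let ?B = "1 / 2 ^ 60 * (real n * real r * log 2 (real k / real n))"
  have rn': "r - 1 \<le> n div 2" and n2: "n \<ge> 2" and r_le_n: "r \<le> n" using rn r by linarith+
  show "ereal ?B \<le> ereal_of_enat (space_usage A n r k)"
  proof (cases "space_usage A n r k")
    case infinity
    then show ?thesis by simp
  next
    case (enat s)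
    have log_le: "log 2 (real k / real n) \<le> log 2 (real k)"
      using n k by (simp add: log_divide)
    have "?B \<le> real s"
    proof (cases "k \<le> n")
      case True
      have "log 2 (real k / real n) \<le> 0" using True n k by (simp add: log_divide)
      then have "real n * real r * log 2 (real k / real n) \<le> 0" by (intro mult_nonneg_nonpos) auto
      then have "?B \<le> 0" by simp
      also have "0 \<le> real s" by simp
      finally show ?thesis .
    next
      case kn: False
      \<comment> \<open>The bound is proved for \<open>log 2 k\<close>, which dominates
        \<open>log 2 (k / n)\<close>.\<close>
      have B_le: "real n * real r * log 2 (real k / real n) \<le> real n * real r * log 2 (real k)"
        using log_le by (intro mult_left_mono) auto
      show ?thesis
      proof (cases "n \<ge> 2 ^ 20")
        case True
        have "real n * real r * log 2 (real k) \<le> 2 ^ 12 * real s"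
          using space_lower_bound_large[OF True r rn' _ kc eps prod] kn enat by simp
        with B_le have "?B \<le> 1 / 2 ^ 60 * (2 ^ 12 * real s)" by (intro mult_left_mono) auto
        also have "\<dots> \<le> real s" by simp
        finally show ?thesis .
      next
        case False
        \<comment> \<open>For \<open>n < 2 ^ 20\<close>, both \<open>r\<close> and
          \<open>log 2 k\<close> are at most \<open>n\<close>, so the product stays below
          \<open>2 ^ 60\<close> and a single bit suffices. This case fixes the constant.\<close>
        have "1 \<le> s" using space_usage_pos[OF prod n2 r eps] enat by (simp add: one_enat_def)
        have "real k \<le> real (2 ^ n)"
          using kc card_hyperedges_le_power[of n r] by (intro of_nat_mono) (rule order_trans)
        then have "log 2 (real k) \<le> log 2 (2 ^ n)" using k by (intro log_mono) auto
        then have "log 2 (real k) \<le> real n" by (simp only: log_pow_cancel)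
        then have "real n * real r * log 2 (real k) \<le> 2 ^ 20 * 2 ^ 20 * 2 ^ 20"
          using False r_le_n k by (intro mult_mono) auto
        with B_le have "?B \<le> 1 / 2 ^ 60 * 2 ^ 60" by (intro mult_left_mono) auto
        also have "\<dots> \<le> real s" using \<open>1 \<le> s\<close> by simp
        finally show ?thesis .
      qed
    qed
    then show ?thesis using enat by simp
  qed
qed simp

end
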